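(* Let $g$ be a positive integer and, for an integer $q$, let $\#\mathcal F(g,q)$ denote the number of gapsets of genus $g$ and depth $q$. Then: (1) $\#\mathcal F(g,1)=1$; (2) $\#\mathcal F(g,2)=\mathbf F_{g+1}-1$; (3) $\#\mathcal F(g,q)=\left\lfloor\frac{g+2q}{3}\right\rfloor+2$ if $\frac{2g+4}{5}<q\le\frac{g-1}{2}$ and $g\ge23$; (4) $\#\mathcal F(g,\frac g2)=\left\lfloor\frac{2g}{3}\right\rfloor+2$ if $g\equiv0\pmod2$ and $g\ge8$; (5) $\#\mathcal F(g,\frac{g+1}{2})=\left\lfloor\frac g3\right\rfloor+2$ if $g\equiv1\pmod2$ and $g\ge5$; (6) $\#\mathcal F(g,q)=2$ if $\frac{g+2}{2}\le q\le\frac{2g}{3}$; (7) $\#\mathcal F(g,\frac{2g+1}{3})=1$ if $g\equiv1\pmod3$ and $g\ge4$; (8) $\#\mathcal F(g,\frac{2g+2}{3})=0$ if $g\equiv2\pmod3$ and $g\ge5$; (9) $\#\mathcal F(g,q)=0$ if $\left\lceil\frac{2g}{3}\right\rceil+1\le q\le g-1$; (10) $\#\mathcal F(g,g)=1$; (11) $\#\mathcal F(g,q)=0$ if $q>g$.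
   Context: A gapset is a finite set $G\subset\mathbb N$ (positive integers) such that whenever $z\in G$ and $z=x+y$ with $x,y\in\mathbb N$, then $x\in G$ or $y\in G$. Its genus is $\#G$, its multiplicity is $m(G)=\min\{s\in\mathbb N_0\setminus G: s\ne0\}$, its conductor is $c(G)=\min\{s\in\mathbb N_0: s+n\notin G\ \forall n\in\mathbb N_0\}$, and its depth is $\lceil c(G)/m(G)\rceil$. The Fibonacci sequence is $\mathbf F_0=0$, $\mathbf F_1=1$, $\mathbf F_n=\mathbf F_{n-1}+\mathbf F_{n-2}$ for $n\ge2$. *)

theory Defs
  imports Complex_Main "HOL-Number_Theory.Fib"
begin

text \<open>Gapsets are subsets of the positive integers, represented as sets of naturals omitting 0.\<close>

definition gapset :: "nat set \<Rightarrow> bool" where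
  "gapset G \<longleftrightarrow> finite G \<and> 0 \<notin> G \<and>
     (\<forall>z\<in>G. \<forall>x y. 0 < x \<longrightarrow> 0 < y \<longrightarrow> z = x + y \<longrightarrow> x \<in> G \<or> y \<in> G)"

definition genus :: "nat set \<Rightarrow> nat" where
  "genus G = card G"

definition multiplicity_gs :: "nat set \<Rightarrow> nat" where
  "multiplicity_gs G = (LEAST s. s \<notin> G \<and> s \<noteq> 0)"

definition conductor :: "nat set \<Rightarrow> nat" where
  "conductor G = (LEAST s. \<forall>n. s + n \<notin> G)"

definition depth :: "nat set \<Rightarrow> int" where
  "depth G = \<lceil>real (conductor G) / real (multiplicity_gs G)\<rceil>"

definition gapsets :: "nat \<Rightarrow> int \<Rightarrow> nat set set" where
  "gapsets g q = {G. gapset G \<and> genus G = g \<and> depth G = q}"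

text \<open>A gapset of genus \<open>g\<close> is contained in \<open>{1..2 * g - 1}\<close>: for \<open>z \<in> G\<close> one of \<open>x\<close>, \<open>z - x\<close>
  lies in \<open>G\<close> for every \<open>0 < x < z\<close>. So the families below are finite and \<^const>\<open>card\<close>
  really counts them.\<close>

lemma gapset_bound:
  assumes "gapset G" "z \<in> G"
  shows "z < 2 * genus G"
proof -
  have fin: "finite G" using assms by (simp add: gapset_def)
  have "{..z} \<subseteq> G \<union> (\<lambda>x. z - x) ` G"
  proof
    fix x assume x: "x \<in> {..z}"
    show "x \<in> G \<union> (\<lambda>x. z - x) ` G"
    proof (cases "x = 0 \<or> x = z")
      case True
      then show ?thesis using assms by force
    next
      case False
      then have "x \<in> G \<or> z - x \<in> G" using x assms by (auto simp: gapset_def)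
      moreover have "x = z - (z - x)" using x by simp
      ultimately show ?thesis by blast
    qed
  qed
  then have "card {..z} \<le> card (G \<union> (\<lambda>x. z - x) ` G)"
    using fin by (intro card_mono) auto
  also have "\<dots> \<le> card G + card ((\<lambda>x. z - x) ` G)" by (rule card_Un_le)
  also have "\<dots> \<le> card G + card G" using card_image_le[OF fin] by simp
  finally show ?thesis by (simp add: genus_def)
qed

lemma finite_gapsets: "finite (gapsets g q)"
proof (rule finite_subset)
  show "gapsets g q \<subseteq> Pow {..<2 * g}"
    using gapset_bound by (auto simp: gapsets_def)
qed simp

end

theory Submission
  imports Defs
begin

text \<open>A gapset of multiplicity \<open>m\<close> is determined by its Kunz coordinates \<open>k\<^sub>1, \<dots>, k\<^sub>m\<^sub>-\<^sub>1 \<ge> 1\<close>,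
  where \<open>k\<^sub>i\<close> is the number of gaps congruent to \<open>i\<close> modulo \<open>m\<close>. The gapset condition becomes a
  system of linear inequalities, the genus is the sum of the coordinates, and the depth is their
  maximum. For \<open>q = 2\<close> the inequalities hold automatically, so one counts the compositions of \<open>g\<close>
  into ones and twos. For large \<open>q\<close>, the bound \<open>z < 2 g\<close> on the gaps gives \<open>(q - 1) m \<le> 2 g - 2\<close>;
  hence \<open>m \<le> 4\<close> in the remaining cases, and at most three coordinates have to be counted.\<close>

section \<open>Kunz coordinates and the gaps they encode\<close>

text \<open>The list \<open>ks\<close> holds \<open>k\<^sub>1, \<dots>, k\<^sub>m\<^sub>-\<^sub>1\<close>, so \<open>m = Suc (length ks)\<close>; consing \<open>0\<close> supplies
  \<open>k\<^sub>0 = 0\<close> and aligns list positions with residues.\<close>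

definition gaps_of :: "nat list \<Rightarrow> nat set" where
  "gaps_of ks = {n. n div Suc (length ks) < (0 # ks) ! (n mod Suc (length ks))}"

text \<open>The Kunz inequalities. The summand \<open>(i + j) div Suc (length ks)\<close> is the
  carry, so a single formula covers residue sums below and above the multiplicity.\<close>

definition kunz :: "nat list \<Rightarrow> bool" where
  "kunz ks \<longleftrightarrow> 0 \<notin> set ks \<and>
     (\<forall>i<Suc (length ks). \<forall>j<Suc (length ks).
        (0 # ks) ! ((i + j) mod Suc (length ks))
          \<le> (0 # ks) ! i + (0 # ks) ! j + (i + j) div Suc (length ks))"

text \<open>A member that bounds all entries encodes the maximum and rules out the empty
  list.\<close>

definition kunz_lists :: "nat \<Rightarrow> nat \<Rightarrow> nat list set" where
  "kunz_lists g q = {ks. kunz ks \<and> sum_list ks = g \<and> q \<in> set ks \<and> (\<forall>k\<in>set ks. k \<le> q)}"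

lemma mem_gaps_of:
  assumes "i < Suc (length ks)"
  shows "j * Suc (length ks) + i \<in> gaps_of ks \<longleftrightarrow> j < (0 # ks) ! i"
proof -
  have "(j * Suc (length ks) + i) div Suc (length ks) = j"
    using assms by (subst div_mult_self3) auto
  moreover have "(j * Suc (length ks) + i) mod Suc (length ks) = i"
    using assms by (subst mod_mult_self3) auto
  ultimately show ?thesis by (simp only: gaps_of_def mem_Collect_eq)
qed

text \<open>Division with remainder by the multiplicity; finiteness and the number of gaps are read
  off from this parametrization.\<close>

lemma gaps_of_eq_image:
  "gaps_of ks = (\<lambda>(i, j). j * Suc (length ks) + i) `
     (SIGMA i:{..<Suc (length ks)}. {..<(0 # ks) ! i})"
proof (intro equalityI subsetI)
  fix n assume "n \<in> gaps_of ks"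
  then have "n div Suc (length ks) < (0 # ks) ! (n mod Suc (length ks))"
    by (simp add: gaps_of_def)
  moreover have "n = n div Suc (length ks) * Suc (length ks) + n mod Suc (length ks)"
    by (rule div_mult_mod_eq [symmetric])
  moreover have "n mod Suc (length ks) < Suc (length ks)" by simp
  ultimately show "n \<in> (\<lambda>(i, j). j * Suc (length ks) + i) `
      (SIGMA i:{..<Suc (length ks)}. {..<(0 # ks) ! i})"
    by (intro image_eqI [where x = "(n mod Suc (length ks), n div Suc (length ks))"])
       (simp_all only: prod.case mem_Sigma_iff lessThan_iff simp_thms)
qed (use mem_gaps_of in force)

lemma finite_gaps_of: "finite (gaps_of ks)"
  unfolding gaps_of_eq_image by (intro finite_imageI finite_SigmaI) auto

lemma card_gaps_of: "card (gaps_of ks) = sum_list ks"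
proof -
  let ?m = "Suc (length ks)"
  have inj: "inj_on (\<lambda>(i, j). j * ?m + i) (SIGMA i:{..<?m}. {..<(0 # ks) ! i})"
  proof (rule inj_onI, clarify)
    fix i j i' j' :: nat
    assume "i < ?m" "i' < ?m" and eq: "j * ?m + i = j' * ?m + i'"
    moreover from this have "i = i'"
      by (metis mod_less mod_mult_self3)
    ultimately show "i = i' \<and> j = j'"
      by (metis add_right_cancel mult_cancel2 nat.distinct(1))
  qed
  have "card (gaps_of ks) = (\<Sum>i<?m. (0 # ks) ! i)"
    unfolding gaps_of_eq_image card_image [OF inj] by (subst card_SigmaI) auto
  also have "\<dots> = sum_list (0 # ks)"
    by (simp add: sum_list_sum_nth atLeast0LessThan del: sum_list.Cons)
  finally show ?thesis by simp
qed

text \<open>A non-gap \<open>x\<close> satisfies \<open>?k (x mod ?m) \<le> x div ?m\<close>. Adding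
  this for \<open>x\<close> and \<open>y\<close>, the Kunz inequality for their residues bounds the
  coordinate of \<open>x + y\<close> by its quotient, since the same carry occurs in both.\<close>

lemma gapset_gaps_of:
  assumes "kunz ks"
  shows "gapset (gaps_of ks)"
proof -
  let ?m = "Suc (length ks)" and ?k = "\<lambda>i. (0 # ks) ! i"
  have "x \<in> gaps_of ks \<or> y \<in> gaps_of ks" if z: "x + y \<in> gaps_of ks" for x y
  proof (rule ccontr)
    assume "\<not> (x \<in> gaps_of ks \<or> y \<in> gaps_of ks)"
    then have "?k (x mod ?m) \<le> x div ?m" "?k (y mod ?m) \<le> y div ?m"
      by (auto simp: gaps_of_def)
    moreover have "?k ((x mod ?m + y mod ?m) mod ?m)
        \<le> ?k (x mod ?m) + ?k (y mod ?m) + (x mod ?m + y mod ?m) div ?m"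
      using assms by (simp only: kunz_def mod_less_divisor zero_less_Suc)
    moreover have "(x + y) div ?m = x div ?m + y div ?m + (x mod ?m + y mod ?m) div ?m"
      by (rule div_add1_eq)
    ultimately have "?k ((x + y) mod ?m) \<le> (x + y) div ?m"
      by (simp only: mod_add_eq)
    with z show False by (simp add: gaps_of_def)
  qed
  moreover have "0 \<notin> gaps_of ks" by (simp add: gaps_of_def)
  ultimately show ?thesis using finite_gaps_of by (auto simp: gapset_def)
qed

text \<open>Each inequality is the gapset condition, contraposed, for the least non-gaps
  \<open>x\<close> and \<open>y\<close> in the classes of \<open>i\<close> and
  \<open>j\<close>.\<close>

lemma kunz_if_gapset:
  assumes gs: "gapset (gaps_of ks)" and pos: "0 \<notin> set ks"
  shows "kunz ks"
  unfolding kunz_def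
proof (intro conjI allI impI)
  let ?m = "Suc (length ks)" and ?k = "\<lambda>i. (0 # ks) ! i"
  fix i j assume ij: "i < ?m" "j < ?m"
  show "?k ((i + j) mod ?m) \<le> ?k i + ?k j + (i + j) div ?m"
  \<comment> \<open>A zero residue would give the summand 0, to which the gapset condition does not
    apply.\<close>
  proof (cases "i = 0 \<or> j = 0")
    case True
    then show ?thesis using ij by auto
  next
    case False
    define x where "x = ?k i * ?m + i"
    define y where "y = ?k j * ?m + j"
    have "x \<notin> gaps_of ks" "y \<notin> gaps_of ks"
      unfolding x_def y_def using ij by (simp_all only: mem_gaps_of less_irrefl simp_thms)
    moreover have "0 < x" "0 < y" using False by (auto simp: x_def y_def)
    ultimately have "x + y \<notin> gaps_of ks" using gs by (auto simp: gapset_def)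
    moreover have "x + y = (?k i + ?k j + (i + j) div ?m) * ?m + (i + j) mod ?m"
    proof -
      have "i + j = (i + j) div ?m * ?m + (i + j) mod ?m" by (rule div_mult_mod_eq [symmetric])
      then show ?thesis unfolding x_def y_def distrib_right by linarith
    qed
    moreover have "(i + j) mod ?m < ?m" by simp
    ultimately show ?thesis using mem_gaps_of by (metis not_less)
  qed
qed (rule pos)

section \<open>Multiplicity and depth in Kunz coordinates\<close>

text \<open>The coordinate 0 of residue 0 makes \<open>Suc (length ks)\<close> a non-gap; positivity
  of the others makes every smaller positive number a gap.\<close>

lemma multiplicity_gaps_of:
  assumes "0 \<notin> set ks"
  shows "multiplicity_gs (gaps_of ks) = Suc (length ks)"
  unfolding multiplicity_gs_def
proof (rule Least_equality)
  show "Suc (length ks) \<notin> gaps_of ks \<and> Suc (length ks) \<noteq> 0"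
    by (simp add: gaps_of_def)
next
  fix s assume s: "s \<notin> gaps_of ks \<and> s \<noteq> 0"
  show "Suc (length ks) \<le> s"
  proof (rule ccontr)
    assume "\<not> Suc (length ks) \<le> s"
    then have "s < Suc (length ks)" by simp
    moreover from this s have "(0 # ks) ! s \<in> set ks"
      by (cases s) auto
    then have "0 < (0 # ks) ! s" using assms by (metis gr0I)
    ultimately show False using s by (simp add: gaps_of_def del: nth_Cons_pos)
  qed
qed

text \<open>No gap reaches \<open>q * ?m\<close>, while \<open>(q - 1) * ?m + i\<close> is a gap for
  a residue \<open>i\<close> with coordinate \<open>q\<close>. Hence
  \<open>(q - 1) * ?m < ?c \<le> q * ?m\<close>.\<close>

lemma depth_gaps_of:
  assumes "0 \<notin> set ks" "q \<in> set ks" "\<forall>k\<in>set ks. k \<le> q"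
  shows "depth (gaps_of ks) = int q"
proof -
  let ?m = "Suc (length ks)" and ?c = "conductor (gaps_of ks)"
  have le: "(0 # ks) ! i \<le> q" if "i < ?m" for i
    using assms(3) that by (cases i) auto
  obtain i where i: "i < ?m" "(0 # ks) ! i = q"
    using assms(2) by (metis in_set_conv_nth length_Cons list.set_intros(2))
  have q: "q > 0" using assms by (auto intro: gr0I)
  have out: "q * ?m + n \<notin> gaps_of ks" for n
  proof -
    have "(0 # ks) ! ((q * ?m + n) mod ?m) \<le> q" by (rule le) simp
    also have "q \<le> (q * ?m + n) div ?m" by (subst div_mult_self3) auto
    finally show ?thesis by (simp add: gaps_of_def)
  qed
  have "?c \<le> q * ?m" unfolding conductor_def using out by (intro Least_le) auto
  have "\<forall>n. ?c + n \<notin> gaps_of ks" unfolding conductor_def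
    by (rule LeastI [where k = "q * ?m"]) (use out in blast)
  moreover have "(q - 1) * ?m + i \<in> gaps_of ks"
    unfolding mem_gaps_of [OF i(1)] using i(2) q by simp
  ultimately have "?c > (q - 1) * ?m"
    by (metis le_add_diff_inverse not_le trans_le_add1)
  with \<open>?c \<le> q * ?m\<close> have c: "real ?c \<le> real (q * ?m)" "real ((q - 1) * ?m) < real ?c"
    by (simp_all only: of_nat_le_iff of_nat_less_iff)
  have "real ((q - 1) * ?m) = (real q - 1) * real ?m"
    using q by (simp only: of_nat_mult of_nat_diff Suc_leI One_nat_def) simp
  with c have "(real q - 1) * real ?m < real ?c" "real ?c \<le> real q * real ?m"
    by (simp_all only: of_nat_mult)
  then show ?thesis
    unfolding depth_def multiplicity_gaps_of [OF assms(1)]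
    by (intro ceiling_unique) (simp_all only: of_int_of_nat_eq pos_less_divide_eq
        pos_divide_le_eq of_nat_0_less_iff zero_less_Suc)
qed

section \<open>The bijection between gapsets and Kunz lists\<close>

text \<open>Since \<open>m\<close> is not a gap, \<open>z + m \<in> G\<close> forces
  \<open>z \<in> G\<close>. So the gaps in each residue class form an initial segment, described by
  its length \<open>k i\<close>.\<close>

lemma gapset_eq_gaps_of:
  assumes gs: "gapset G"
  obtains ks where "G = gaps_of ks" "0 \<notin> set ks"
proof -
  define m where "m = multiplicity_gs G"
  have fin: "finite G" using gs by (simp add: gapset_def)
  obtain b where b: "\<And>z. z \<in> G \<Longrightarrow> z < b"
    using fin finite_nat_set_iff_bounded by auto
  have "m \<notin> G \<and> m \<noteq> 0" unfolding m_def multiplicity_gs_def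
    by (rule LeastI [where k = "Suc b"]) (use b [of "Suc b"] in auto)
  then have m: "m \<notin> G" "0 < m" by auto
  have small: "s \<in> G" if "0 < s" "s < m" for s
    using not_less_Least [of s "\<lambda>s. s \<notin> G \<and> s \<noteq> 0"] that
    by (auto simp: m_def multiplicity_gs_def)
  have zero: "0 \<notin> G" using gs by (simp add: gapset_def)
  have step: "z \<in> G" if "z + m \<in> G" for z
  proof -
    have "z \<noteq> 0" using that m(1) by (intro notI) simp
    then have "z \<in> G \<or> m \<in> G"
      using gs that m(2) unfolding gapset_def by blast
    then show ?thesis using m(1) by simp
  qed
  have down: "j * m + i \<in> G" if "(j + d) * m + i \<in> G" for i j d
    using that
  proof (induction d)
    case (Suc d)
    have "(j + Suc d) * m + i = ((j + d) * m + i) + m" by simp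
    with Suc.prems have "((j + d) * m + i) + m \<in> G" by (simp only:)
    then show ?case by (rule Suc.IH [OF step])
  qed simp
  define k where "k i = (LEAST j. j * m + i \<notin> G)" for i
  \<comment> \<open>As \<open>m\<close> is positive, this number is at least the bound
    \<open>b\<close>, so the \<open>LEAST\<close> in \<open>k\<close> has a witness.\<close>
  have "b * m + i \<notin> G" for i
    using b [of "b * m + i"] m(2) by (cases m) auto
  then have k: "k i * m + i \<notin> G" for i
    unfolding k_def by (rule LeastI)
  have mem: "j * m + i \<in> G \<longleftrightarrow> j < k i" for i j
  proof
    assume "j * m + i \<in> G"
    then show "j < k i"
      using k [of i] down [of "k i" _ i] by (metis le_add_diff_inverse not_less)
  next
    assume "j < k i"
    then show "j * m + i \<in> G"
      unfolding k_def by (blast dest: not_less_Least)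
  qed
  define ks where "ks = map k [1..<m]"
  have len: "Suc (length ks) = m" using m(2) by (simp add: ks_def)
  have nth: "(0 # ks) ! i = k i" if "i < m" for i
  proof (cases i)
    case 0
    then show ?thesis using mem [of 0 0] zero by simp
  next
    case (Suc n)
    then show ?thesis using that by (simp add: ks_def)
  qed
  have "n \<in> G \<longleftrightarrow> n \<in> gaps_of ks" for n
  proof -
    have "n \<in> G \<longleftrightarrow> n div m < k (n mod m)"
      using mem [of "n div m" "n mod m"] by (simp only: div_mult_mod_eq)
    also have "k (n mod m) = (0 # ks) ! (n mod m)"
      by (rule nth [symmetric]) (simp add: m(2))
    finally show ?thesis unfolding gaps_of_def len mem_Collect_eq .
  qed
  moreover have "0 \<notin> set ks"
  proof
    assume "0 \<in> set ks"
    then have "0 \<in> k ` {1..<m}" by (simp add: ks_def)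
    then obtain i where i: "i \<in> {1..<m}" "k i = 0" by (metis imageE)
    then show False using small [of i] mem [of 0 i] by simp
  qed
  ultimately show ?thesis by (intro that [of ks] set_eqI)
qed

text \<open>The multiplicity recovers the length of the list, and membership in each residue class
  recovers the entries.\<close>

lemma bij_betw_gaps_of:
  assumes "q > 0"
  shows "bij_betw gaps_of (kunz_lists g q) (gapsets g (int q))"
proof (rule bij_betw_imageI)
  show "inj_on gaps_of (kunz_lists g q)"
  proof (rule inj_onI)
    fix ks ls assume *: "ks \<in> kunz_lists g q" "ls \<in> kunz_lists g q" "gaps_of ks = gaps_of ls"
    then have "Suc (length ks) = Suc (length ls)"
      by (metis (no_types, lifting) multiplicity_gaps_of kunz_lists_def kunz_def mem_Collect_eq)
    then have len: "length ks = length ls" by simp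
    show "ks = ls"
    proof (rule nth_equalityI [OF len])
      fix i assume i: "i < length ks"
      then have "j < ks ! i \<longleftrightarrow> j < ls ! i" for j
        using mem_gaps_of [of "Suc i" ks j] mem_gaps_of [of "Suc i" ls j] * len by simp
      then show "ks ! i = ls ! i" by (metis linorder_neq_iff)
    qed
  qed
  show "gaps_of ` kunz_lists g q = gapsets g (int q)"
  proof (intro equalityI subsetI)
    fix G assume "G \<in> gaps_of ` kunz_lists g q"
    then show "G \<in> gapsets g (int q)"
      using gapset_gaps_of depth_gaps_of card_gaps_of
      by (auto simp: gapsets_def kunz_lists_def genus_def kunz_def)
  next
    fix G assume G: "G \<in> gapsets g (int q)"
    then obtain ks where ks: "G = gaps_of ks" "0 \<notin> set ks"
      using gapset_eq_gaps_of by (auto simp: gapsets_def)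
    \<comment> \<open>The empty list encodes the empty gapset, whose depth is 0.\<close>
    have ne: "ks \<noteq> []"
    proof
      assume "ks = []"
      then have "G = {}" by (simp add: ks gaps_of_def)
      then have "depth G = 0" by (simp add: depth_def conductor_def)
      then show False using G assms by (simp add: gapsets_def)
    qed
    have "depth G = int (Max (set ks))"
      unfolding ks(1) by (rule depth_gaps_of) (use ks ne in auto)
    then have "q = Max (set ks)" using G by (simp add: gapsets_def)
    then have "ks \<in> kunz_lists g q"
      using G ks ne kunz_if_gapset card_gaps_of
      by (auto simp: kunz_lists_def gapsets_def genus_def)
    then show "G \<in> gaps_of ` kunz_lists g q" using ks by blast
  qed
qed

lemma card_gapsets: "q > 0 \<Longrightarrow> card (gapsets g (int q)) = card (kunz_lists g q)"
  using bij_betw_gaps_of bij_betw_same_card by metis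

text \<open>The gap \<open>(q - 1) * Suc (length ks) + Suc i\<close> at an entry \<open>q\<close> is
  below \<open>2 * g\<close>, and \<open>Suc i\<close> is at least 1. This bounds the multiplicity
  when \<open>q\<close> is large.\<close>

lemma length_kunz_lists:
  assumes "ks \<in> kunz_lists g q"
  shows "(q - 1) * Suc (length ks) + 2 \<le> 2 * g"
proof -
  have ks: "kunz ks" "sum_list ks = g" "q \<in> set ks" "0 \<notin> set ks"
    using assms by (auto simp: kunz_lists_def kunz_def)
  obtain i where i: "i < length ks" "ks ! i = q"
    using ks(3) by (auto simp: in_set_conv_nth)
  have "q > 0" using ks by (auto intro: gr0I)
  then have "(q - 1) * Suc (length ks) + Suc i \<in> gaps_of ks"
    using i by (subst mem_gaps_of) auto
  from gapset_bound [OF gapset_gaps_of [OF ks(1)] this] show ?thesis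
    using ks by (simp add: genus_def card_gaps_of)
qed

section \<open>Depths one and two\<close>

text \<open>For nonzero residues the right side is at least 1 + 1 and the left side at most 2; a
  zero residue leaves a trivial inequality.\<close>

lemma kunz_le_2:
  assumes "set ks \<subseteq> {1, 2}"
  shows "kunz ks"
  unfolding kunz_def
proof (intro conjI allI impI)
  show "0 \<notin> set ks" using assms by auto
  let ?m = "Suc (length ks)"
  have le: "(0 # ks) ! i \<le> 2" "i \<noteq> 0 \<Longrightarrow> 1 \<le> (0 # ks) ! i" if "i < ?m" for i
    using assms that by (cases i; force dest: nth_mem)+
  fix i j assume ij: "i < ?m" "j < ?m"
  have "(0 # ks) ! ((i + j) mod ?m) \<le> 2" by (rule le) simp
  then show "(0 # ks) ! ((i + j) mod ?m) \<le> (0 # ks) ! i + (0 # ks) ! j + (i + j) div ?m"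
    using le(2) [of i] le(2) [of j] ij by (cases "i = 0"; cases "j = 0") auto
qed

text \<open>Removing the first entry, 1 or 2, yields the Fibonacci recursion.\<close>

lemma card_lists_1_2: "card {ks. set ks \<subseteq> {1, 2} \<and> sum_list ks = n} = fib (Suc n)"
proof (induction n rule: fib.induct)
  case 1
  have "{ks. set ks \<subseteq> {1, 2} \<and> sum_list ks = (0::nat)} = {[]}"
  proof (intro equalityI subsetI)
    fix ks :: "nat list" assume "ks \<in> {ks. set ks \<subseteq> {1, 2} \<and> sum_list ks = 0}"
    then show "ks \<in> {[]}" by (cases ks) auto
  qed simp
  then show ?case by simp
next
  case 2
  have "ks = [1]" if "set ks \<subseteq> {1, 2}" "sum_list ks = Suc 0" for ks :: "nat list"
    using that by (cases ks; cases "tl ks") auto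
  then have "{ks. set ks \<subseteq> {1, 2} \<and> sum_list ks = Suc 0} = {[1]}" by auto
  then show ?case by simp
next
  case (3 n)
  let ?L = "\<lambda>n. {ks. set ks \<subseteq> {1, 2} \<and> sum_list ks = (n::nat)}"
  have fin: "finite (?L n)" for n
  proof (rule finite_subset)
    have "length ks \<le> sum_list ks" if "set ks \<subseteq> {1, 2::nat}" for ks
      using that by (induction ks) auto
    then show "?L n \<subseteq> {ks. set ks \<subseteq> {1, 2} \<and> length ks \<le> n}" by auto
  qed (rule finite_lists_length_le, simp)
  have "?L (Suc (Suc n)) = (#) 1 ` ?L (Suc n) \<union> (#) 2 ` ?L n" (is "_ = ?R")
  proof (intro equalityI subsetI)
    fix ks assume "ks \<in> ?L (Suc (Suc n))"
    then show "ks \<in> ?R" by (cases ks) auto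
  qed auto
  moreover have "card ?R = card (?L (Suc n)) + card (?L n)"
    by (subst card_Un_disjoint) (auto intro!: finite_imageI fin [simplified] simp: card_image)
  ultimately show ?case using 3 by simp
qed

lemma all_1_eq_replicate:
  fixes ks :: "nat list"
  shows "\<forall>k\<in>set ks. k = 1 \<Longrightarrow> ks = replicate (sum_list ks) 1"
  by (induction ks) auto

text \<open>The all-ones list is the only one in which 2 does not occur; it accounts for the
  subtracted 1 in the count.\<close>

lemma kunz_lists_2: "kunz_lists g 2 = {ks. set ks \<subseteq> {1, 2} \<and> sum_list ks = g} - {replicate g 1}"
proof (intro equalityI subsetI)
  fix ks assume ks: "ks \<in> kunz_lists g 2"
  have "k = 1 \<or> k = 2" if "k \<in> set ks" for k
    using ks that unfolding kunz_lists_def kunz_def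
    by (metis (no_types, lifting) One_nat_def less_2_cases le_neq_implies_less mem_Collect_eq)
  moreover have "ks \<noteq> replicate g 1"
  proof
    assume "ks = replicate g 1"
    then have "2 \<in> set (replicate g (1::nat))" using ks by (simp add: kunz_lists_def)
    then show False by simp
  qed
  ultimately show "ks \<in> {ks. set ks \<subseteq> {1, 2} \<and> sum_list ks = g} - {replicate g 1}"
    using ks by (auto simp: kunz_lists_def)
next
  fix ks assume ks: "ks \<in> {ks. set ks \<subseteq> {1, 2} \<and> sum_list ks = g} - {replicate g 1}"
  have "2 \<in> set ks"
  proof (rule ccontr)
    assume "2 \<notin> set ks"
    then have "\<forall>k\<in>set ks. k = 1" using ks by auto
    then show False using all_1_eq_replicate [of ks] ks by simp
  qed
  then show "ks \<in> kunz_lists g 2" using ks kunz_le_2 by (auto simp: kunz_lists_def)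
qed

lemma card_kunz_lists_2: "card (kunz_lists g 2) = fib (Suc g) - 1"
proof -
  have "replicate g 1 \<in> {ks. set ks \<subseteq> {1, 2} \<and> sum_list ks = g}"
    by (auto simp: sum_list_replicate)
  then show ?thesis unfolding kunz_lists_2 by (subst card_Diff_singleton) (simp_all only: card_lists_1_2)
qed

lemma kunz_lists_1:
  assumes "g > 0"
  shows "kunz_lists g 1 = {replicate g 1}"
proof (intro equalityI subsetI)
  fix ks assume ks: "ks \<in> kunz_lists g 1"
  then have "\<forall>k\<in>set ks. k = 1"
    by (metis (no_types, lifting) One_nat_def Suc_leI gr0I kunz_def kunz_lists_def le_antisym mem_Collect_eq)
  then have "ks = replicate (sum_list ks) 1" by (rule all_1_eq_replicate)
  moreover have "sum_list ks = g" using ks by (simp add: kunz_lists_def)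
  ultimately show "ks \<in> {replicate g 1}" by simp
next
  fix ks :: "nat list" assume "ks \<in> {replicate g 1}"
  moreover have "kunz (replicate g 1)" by (rule kunz_le_2) auto
  ultimately show "ks \<in> kunz_lists g 1"
    using assms by (simp add: kunz_lists_def sum_list_replicate)
qed

section \<open>Kunz lists of length at most three\<close>

lemma kunz_list_1: "kunz [a] \<longleftrightarrow> 0 < a"
  by (simp add: kunz_def All_less_Suc)

lemma kunz_list_2: "kunz [a, b] \<longleftrightarrow> 0 < a \<and> 0 < b \<and> b \<le> 2 * a \<and> a \<le> 2 * b + 1"
  by (simp add: kunz_def All_less_Suc mult_2 conj_ac)

text \<open>Up to symmetry, the residue pairs (1,1), (1,2), (2,3), (3,3) give the four inequalities
  in this order; all other pairs contain 0 or sum to 4.\<close>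

lemma kunz_list_3: "kunz [a, b, c] \<longleftrightarrow> 0 < a \<and> 0 < b \<and> 0 < c \<and>
     b \<le> 2 * a \<and> c \<le> a + b \<and> a \<le> b + c + 1 \<and> b \<le> 2 * c + 1"
  by (simp add: kunz_def All_less_Suc mult_2 add_ac conj_ac)

lemma kunz_lists_length_1: "{ks \<in> kunz_lists g q. length ks = 1} = (if q = g \<and> g > 0 then {[g]} else {})"
proof (intro equalityI subsetI)
  fix ks assume "ks \<in> {ks \<in> kunz_lists g q. length ks = 1}"
  then show "ks \<in> (if q = g \<and> g > 0 then {[g]} else {})"
    by (auto simp: kunz_lists_def kunz_list_1 length_Suc_conv)
next
  fix ks assume "ks \<in> (if q = g \<and> g > 0 then {[g]} else {})"
  then show "ks \<in> {ks \<in> kunz_lists g q. length ks = 1}"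
    by (auto simp: kunz_lists_def kunz_list_1 split: if_splits)
qed

text \<open>The other entry is \<open>g - q\<close>, and \<open>g \<le> 2 * q\<close> keeps it at
  most \<open>q\<close>. With \<open>q\<close> first the decisive inequality has a carry,
  \<open>q \<le> 2 * (g - q) + 1\<close>; with \<open>q\<close> second it has none.\<close>

lemma kunz_lists_length_2:
  assumes "q < g"
  shows "{ks \<in> kunz_lists g q. length ks = 2} =
    (if g \<le> 2 * q \<and> 3 * q \<le> 2 * g + 1 then {[q, g - q]} else {}) \<union>
    (if g \<le> 2 * q \<and> 3 * q \<le> 2 * g then {[g - q, q]} else {})"
  (is "_ = ?R")
proof (intro equalityI subsetI)
  fix ks assume ks: "ks \<in> {ks \<in> kunz_lists g q. length ks = 2}"
  then obtain a b where ab: "ks = [a, b]" by (auto simp: length_Suc_conv numeral_2_eq_2)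
  have "a + b = g" "b \<le> 2 * a" "a \<le> 2 * b + 1" "q = a \<or> q = b" "a \<le> q" "b \<le> q"
    using ks unfolding ab by (auto simp: kunz_lists_def kunz_list_2)
  then show "ks \<in> ?R" unfolding ab by auto
next
  fix ks assume "ks \<in> ?R"
  then show "ks \<in> {ks \<in> kunz_lists g q. length ks = 2}"
    using assms by (auto simp: kunz_lists_def kunz_list_2 split: if_splits)
qed

text \<open>The three parts are the lists whose largest entry \<open>q\<close> occurs second, or first but not
  second, or only in the third position.\<close>

lemma kunz_lists_length_3:
  assumes "5 \<le> g" "2 * q \<le> g + 1" "2 * g + 1 < 5 * q"
  shows "{ks \<in> kunz_lists g q. length ks = 3} =
    (\<lambda>a. [a, q, g - q - a]) ` {a. q \<le> 2 * a \<and> 2 * a + 3 * q \<le> 2 * g + 1} \<union>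
    (\<lambda>b. [q, b, g - q - b]) ` {b. 0 < b \<and> g \<le> 2 * q + b \<and> 3 * b + 2 * q \<le> 2 * g + 1} \<union>
    (\<lambda>b. [g - q - b, b, q]) ` {b. 0 < b \<and> 2 * q \<le> g \<and> g < 2 * q + b \<and> 3 * b + 2 * q \<le> 2 * g}"
  (is "_ = ?A \<union> ?B \<union> ?C")
proof (intro equalityI subsetI)
  fix ks assume ks: "ks \<in> {ks \<in> kunz_lists g q. length ks = 3}"
  then obtain a b c where abc: "ks = [a, b, c]" by (auto simp: length_Suc_conv numeral_3_eq_3)
  have *: "a + b + c = g" "0 < a" "0 < b" "0 < c" "b \<le> 2 * a" "c \<le> a + b" "a \<le> b + c + 1"
    "b \<le> 2 * c + 1" "a \<le> q" "b \<le> q" "c \<le> q" "q = a \<or> q = b \<or> q = c"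
    using ks unfolding abc by (auto simp: kunz_lists_def kunz_list_3)
  \<comment> \<open>Each index set arises by eliminating one entry through
    \<open>a + b + c = g\<close>. For instance, \<open>b = q\<close> turns
    \<open>b \<le> 2 * c + 1\<close> into \<open>2 * a + 3 * q \<le> 2 * g + 1\<close>, and
    \<open>c = q\<close> turns \<open>c \<le> a + b\<close> into
    \<open>2 * q \<le> g\<close>.\<close>
  consider "b = q" | "a = q" "b \<noteq> q" | "c = q" "a \<noteq> q" "b \<noteq> q"
    using * by auto
  then show "ks \<in> ?A \<union> ?B \<union> ?C"
  proof cases
    case 1
    then have "ks \<in> ?A" unfolding abc using * by (intro image_eqI [where x = a]) auto
    then show ?thesis by blast
  next
    case 2
    then have "ks \<in> ?B" unfolding abc using * by (intro image_eqI [where x = b]) auto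
    then show ?thesis by blast
  next
    case 3
    then have "ks \<in> ?C" unfolding abc using * by (intro image_eqI [where x = b]) auto
    then show ?thesis by blast
  qed
next
  fix ks assume "ks \<in> ?A \<union> ?B \<union> ?C"
  moreover have "[a, b, c] \<in> {ks \<in> kunz_lists g q. length ks = 3}"
    if "a + b + c = g" "0 < a" "0 < b" "0 < c" "b \<le> 2 * a" "c \<le> a + b" "a \<le> b + c + 1"
      "b \<le> 2 * c + 1" "a \<le> q" "b \<le> q" "c \<le> q" "q = a \<or> q = b \<or> q = c" for a b c
    using that by (auto simp: kunz_lists_def kunz_list_3)
  ultimately show "ks \<in> {ks \<in> kunz_lists g q. length ks = 3}"
    using assms by (elim UnE imageE CollectE conjE; hypsubst) simp_all
qed

text \<open>The parametrizations are injective and the parts disjoint: by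
  \<open>2 * g + 1 < 5 * q\<close> the second entry differs from \<open>q\<close> in the last two
  parts, and \<open>g < 2 * q + b\<close> keeps the first entry of the third part from being
  \<open>q\<close>.\<close>

lemma card_kunz_lists_length_3:
  assumes "5 \<le> g" "2 * q \<le> g + 1" "2 * g + 1 < 5 * q"
  shows "card {ks \<in> kunz_lists g q. length ks = 3} =
    card {a. q \<le> 2 * a \<and> 2 * a + 3 * q \<le> 2 * g + 1} +
    card {b. 0 < b \<and> g \<le> 2 * q + b \<and> 3 * b + 2 * q \<le> 2 * g + 1} +
    card {b. 0 < b \<and> 2 * q \<le> g \<and> g < 2 * q + b \<and> 3 * b + 2 * q \<le> 2 * g}"
  (is "_ = card ?A + card ?B + card ?C")
proof -
  have fin: "finite ?A" "finite ?B" "finite ?C"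
    by (rule finite_subset [of _ "{..2 * g + 1}"]; force)+
  show ?thesis
    unfolding kunz_lists_length_3 [OF assms]
  proof (subst card_Un_disjoint)
    show "((\<lambda>a. [a, q, g - q - a]) ` ?A \<union> (\<lambda>b. [q, b, g - q - b]) ` ?B)
        \<inter> (\<lambda>b. [g - q - b, b, q]) ` ?C = {}"
      using assms by auto
    show "card ((\<lambda>a. [a, q, g - q - a]) ` ?A \<union> (\<lambda>b. [q, b, g - q - b]) ` ?B)
        + card ((\<lambda>b. [g - q - b, b, q]) ` ?C) = card ?A + card ?B + card ?C"
    proof (subst card_Un_disjoint)
      show "(\<lambda>a. [a, q, g - q - a]) ` ?A \<inter> (\<lambda>b. [q, b, g - q - b]) ` ?B = {}"
        using assms by auto
    qed (use fin in \<open>simp_all add: card_image inj_on_def\<close>)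
  qed (use fin in simp_all)
qed

text \<open>With \<open>g = 2 * q + d\<close> the three index sets are intervals. The case
  \<open>d = 0\<close> is special because the second interval starts at
  \<open>max 1 d\<close>.\<close>

lemma card_kunz_lists_length_3_le_half:
  assumes "5 \<le> g" "2 * g + 1 < 5 * q" "2 * q \<le> g"
  shows "card {ks \<in> kunz_lists g q. length ks = 3} =
    (if 2 * q = g then 4 * q div 3 + 1 else (g + 2 * q) div 3 + 2)"
proof -
  obtain d where g: "g = 2 * q + d" using assms(3) le_Suc_ex by blast
  have q: "2 * d + 1 < q" using assms(2) g by simp
  have "{a. q \<le> 2 * a \<and> 2 * a + 3 * q \<le> 2 * g + 1} = {(q + 1) div 2..(q + 1) div 2 + d}"
    unfolding g by auto
  moreover have "{b. 0 < b \<and> g \<le> 2 * q + b \<and> 3 * b + 2 * q \<le> 2 * g + 1}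
      = {max 1 d..(2 * (q + d) + 1) div 3}"
    unfolding g by auto
  moreover have "{b. 0 < b \<and> 2 * q \<le> g \<and> g < 2 * q + b \<and> 3 * b + 2 * q \<le> 2 * g}
      = {d + 1..2 * (q + d) div 3}"
    unfolding g by auto
  ultimately have *: "card {ks \<in> kunz_lists g q. length ks = 3} =
      (d + 1) + (Suc ((2 * (q + d) + 1) div 3) - max 1 d) + (2 * (q + d) div 3 - d)"
    using q assms(1) by (subst card_kunz_lists_length_3) (simp_all add: g)
  \<comment> \<open>Merges the upper ends of the last two intervals into one quotient, by the
    residue of \<open>x\<close> modulo 3.\<close>
  have "(2 * x + 1) div 3 + 2 * x div 3 = 4 * x div 3" for x :: nat
  proof -
    have "x mod 3 = 0 \<or> x mod 3 = 1 \<or> x mod 3 = 2" by auto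
    then have "x = 3 * (x div 3) \<or> x = 3 * (x div 3) + 1 \<or> x = 3 * (x div 3) + 2"
      by (metis add_0_right mult_div_mod_eq)
    then obtain t where "x = 3 * t \<or> x = 3 * t + 1 \<or> x = 3 * t + 2" by blast
    moreover have "(6 * t + 2) div 3 = 2 * t" "(6 * t + 4) div 3 = 2 * t + 1"
      "(6 * t + 5) div 3 = 2 * t + 1" "(12 * t + 4) div 3 = 4 * t + 1" "(12 * t + 8) div 3 = 4 * t + 2"
      by (intro div_nat_eqI; simp)+
    ultimately show ?thesis by (elim disjE) (simp_all add: add.commute)
  qed
  from this [of "q + d"] have "(2 * (q + d) + 1) div 3 + 2 * (q + d) div 3 = 4 * (q + d) div 3" .
  moreover have "d \<le> 2 * (q + d) div 3" "d \<le> (2 * (q + d) + 1) div 3"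
    using q by (simp_all add: less_eq_div_iff_mult_less_eq)
  moreover have "4 * (q + d) div 3 = (g + 2 * q) div 3 + d"
  proof -
    have "4 * (q + d) = (g + 2 * q) + d * 3" unfolding g by simp
    then show ?thesis by simp
  qed
  ultimately show ?thesis unfolding * using g by (simp split: split_max)
qed

text \<open>Only lists starting with \<open>q\<close> survive, and
  \<open>3 * b + 2 * q \<le> 2 * g + 1\<close> becomes \<open>3 * b \<le> g\<close>.\<close>

lemma card_kunz_lists_length_3_half:
  assumes "g + 1 = 2 * q" "g \<ge> 5"
  shows "card {ks \<in> kunz_lists g q. length ks = 3} = g div 3"
proof -
  have "{a. q \<le> 2 * a \<and> 2 * a + 3 * q \<le> 2 * g + 1} = {}"
    using assms by auto
  moreover have "{b. 0 < b \<and> g \<le> 2 * q + b \<and> 3 * b + 2 * q \<le> 2 * g + 1} = {1..g div 3}"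
    using assms by auto
  moreover have "{b. 0 < b \<and> 2 * q \<le> g \<and> g < 2 * q + b \<and> 3 * b + 2 * q \<le> 2 * g} = {}"
    using assms by auto
  moreover have "2 * q \<le> g + 1" "2 * g + 1 < 5 * q" using assms by linarith+
  ultimately show ?thesis
    by (simp only: card_kunz_lists_length_3 [OF assms(2)]) simp
qed

section \<open>Counting for large depth\<close>

text \<open>The first assumption says that length \<open>n + 1\<close> already violates
  \<open>length_kunz_lists\<close>. Length 1 would force \<open>q = g\<close>, so the sum starts at
  2.\<close>

lemma card_kunz_lists_short:
  assumes "2 * g < (q - 1) * (n + 2) + 2" "q < g"
  shows "card (kunz_lists g q) = (\<Sum>i=2..n. card {ks \<in> kunz_lists g q. length ks = i})"
proof -
  have "kunz_lists g q = (\<Union>i\<in>{2..n}. {ks \<in> kunz_lists g q. length ks = i})"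
  proof (intro equalityI subsetI)
    fix ks assume ks: "ks \<in> kunz_lists g q"
    have "length ks \<le> n"
    proof (rule ccontr)
      assume "\<not> length ks \<le> n"
      then have "(q - 1) * (n + 2) \<le> (q - 1) * Suc (length ks)" by (intro mult_le_mono2) simp
      with length_kunz_lists [OF ks] assms(1) show False by linarith
    qed
    moreover have "ks \<noteq> []" using ks by (auto simp: kunz_lists_def)
    moreover have "length ks \<noteq> 1" using kunz_lists_length_1 [of g q] ks assms(2) by auto
    ultimately show "ks \<in> (\<Union>i\<in>{2..n}. {ks \<in> kunz_lists g q. length ks = i})"
      using ks by (cases ks) (auto simp: Suc_le_eq)
  qed auto
  moreover have "finite (kunz_lists g q)"
  proof (cases "q = 0")
    case True
    then have "kunz_lists g q = {}" by (auto simp: kunz_lists_def kunz_def)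
    then show ?thesis by simp
  next
    case False
    then show ?thesis
      using bij_betw_gaps_of [of q g] finite_gapsets by (metis bij_betw_finite gr0I)
  qed
  ultimately have "card (kunz_lists g q) = card (\<Union>i\<in>{2..n}. {ks \<in> kunz_lists g q. length ks = i})"
    by simp
  also have "\<dots> = (\<Sum>i=2..n. card {ks \<in> kunz_lists g q. length ks = i})"
    using \<open>finite (kunz_lists g q)\<close> by (intro card_UN_disjoint) auto
  finally show ?thesis .
qed

text \<open>For \<open>g = 2 * q\<close> the two candidates coincide; for
  \<open>3 * q = 2 * g + 1\<close> only the one starting with \<open>q\<close> remains.\<close>

lemma card_kunz_lists_length_2:
  assumes "q < g"
  shows "card {ks \<in> kunz_lists g q. length ks = 2} =
    (if g = 2 * q then 1 else if g \<le> 2 * q \<and> 3 * q \<le> 2 * g then 2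
     else if 3 * q = 2 * g + 1 then 1 else 0)"
proof -
  consider "g = 2 * q" | "g < 2 * q" "3 * q \<le> 2 * g" | "3 * q = 2 * g + 1"
    | "g > 2 * q \<or> 3 * q > 2 * g + 1" by linarith
  then show ?thesis
  proof cases
    case 2
    then have "[q, g - q] \<noteq> [g - q, q]" by auto
    then show ?thesis using 2 unfolding kunz_lists_length_2 [OF assms] by simp
  qed (use assms in \<open>auto simp: kunz_lists_length_2\<close>)
qed

lemma kunz_lists_self:
  assumes "g > 0"
  shows "kunz_lists g g = {[g]}"
proof (intro equalityI subsetI)
  fix ks assume ks: "ks \<in> kunz_lists g g"
  show "ks \<in> {[g]}"
  \<comment> \<open>For \<open>g = 1\<close> the factor \<open>g - 1\<close> vanishes and the length
    bound says nothing.\<close>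
  proof (cases "g = 1")
    case True
    then show ?thesis using ks kunz_lists_1 [of 1] by simp
  next
    case False
    have "(g - 1) * Suc (length ks) \<le> (g - 1) * 2"
      using length_kunz_lists [OF ks] by simp
    then have "Suc (length ks) \<le> 2"
      using False assms by (subst (asm) mult_le_cancel1) auto
    then have "length ks \<le> 1" by simp
    moreover have "ks \<noteq> []" using ks by (auto simp: kunz_lists_def)
    ultimately have "length ks = 1" by (cases ks) auto
    then show ?thesis using ks kunz_lists_length_1 [of g g] assms by auto
  qed
qed (use kunz_lists_length_1 [of g g] assms in auto)

lemma kunz_lists_greater:
  assumes "q > g"
  shows "kunz_lists g q = {}"
proof (rule equals0I)
  fix ks assume "ks \<in> kunz_lists g q"
  then have "q \<in> set ks" "sum_list ks = g" by (auto simp: kunz_lists_def)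
  then show False using member_le_sum_list [of q ks] assms by simp
qed

text \<open>Here \<open>4 * (q - 1) + 2 > 2 * g\<close>, so the multiplicity is at most 3.\<close>

lemma card_kunz_lists_ge_half:
  assumes "g + 2 \<le> 2 * q" "q < g"
  shows "card (kunz_lists g q) = (if 3 * q \<le> 2 * g then 2 else if 3 * q = 2 * g + 1 then 1 else 0)"
proof -
  have "2 * g < (q - 1) * (2 + 2) + 2" using assms by simp
  then have "card (kunz_lists g q) = card {ks \<in> kunz_lists g q. length ks = 2}"
    using card_kunz_lists_short [of g q 2] assms(2) by simp
  then show ?thesis using assms(1) card_kunz_lists_length_2 [OF assms(2)] by simp
qed

text \<open>Here \<open>5 * (q - 1) + 2 > 2 * g\<close>, so the multiplicity is at most 4.\<close>

lemma card_kunz_lists_le_3: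
  assumes "2 * g + 3 < 5 * q" "q < g"
  shows "card (kunz_lists g q) =
    card {ks \<in> kunz_lists g q. length ks = 2} + card {ks \<in> kunz_lists g q. length ks = 3}"
proof -
  have "2 * g < (q - 1) * (3 + 2) + 2" using assms(1) by simp
  moreover have "{2..3::nat} = {2, 3}" by auto
  ultimately show ?thesis
    using card_kunz_lists_short [of g q 3] assms(2) by simp
qed

text \<open>Below half, only length 3 contributes. At \<open>2 * q = g\<close> length 3 yields one
  list less than the general formula, and \<open>[q, q]\<close> makes up for it.\<close>

lemma card_kunz_lists_le_half:
  assumes "8 \<le> g" "2 * g + 4 < 5 * q \<or> 2 * q = g" "2 * q \<le> g"
  shows "card (kunz_lists g q) = (g + 2 * q) div 3 + 2"
proof -
  have *: "2 * g + 3 < 5 * q" "q < g" "2 * g + 1 < 5 * q" "5 \<le> g" using assms by linarith+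
  show ?thesis
  proof (cases "2 * q = g")
    case True
    then have "4 * q = g + 2 * q" by simp
    then show ?thesis
      unfolding card_kunz_lists_le_3 [OF *(1,2)] card_kunz_lists_length_2 [OF *(2)]
        card_kunz_lists_length_3_le_half [OF *(4,3) assms(3)] using True by simp
  next
    case False
    then show ?thesis
      unfolding card_kunz_lists_le_3 [OF *(1,2)] card_kunz_lists_length_2 [OF *(2)]
        card_kunz_lists_length_3_le_half [OF *(4,3) assms(3)] using assms(3) by simp
  qed
qed

lemma card_kunz_lists_half:
  assumes "g + 1 = 2 * q" "5 \<le> g"
  shows "card (kunz_lists g q) = g div 3 + 2"
proof -
  have *: "2 * g + 3 < 5 * q" "q < g" "g \<noteq> 2 * q" "g \<le> 2 * q" "3 * q \<le> 2 * g"
    using assms by linarith+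
  then show ?thesis
    unfolding card_kunz_lists_le_3 [OF *(1,2)] card_kunz_lists_length_2 [OF *(2)]
      card_kunz_lists_length_3_half [OF assms] by simp
qed

section \<open>Transfer to gapsets and to the real bounds on the depth\<close>

theorem theorem7p4:
  fixes g :: nat
  assumes "g > 0"
  shows
    "card (gapsets g 1) = 1 \<and>
     int (card (gapsets g 2)) = int (fib (g + 1)) - 1 \<and>
     (\<forall>q::int. (2 * real g + 4) / 5 < real_of_int q \<and> real_of_int q \<le> (real g - 1) / 2 \<and> g \<ge> 23
        \<longrightarrow> int (card (gapsets g q)) = \<lfloor>(real g + 2 * real_of_int q) / 3\<rfloor> + 2) \<and>
     (\<forall>q::int. real_of_int q = real g / 2 \<and> g mod 2 = 0 \<and> g \<ge> 8
        \<longrightarrow> int (card (gapsets g q)) = \<lfloor>2 * real g / 3\<rfloor> + 2) \<and>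
     (\<forall>q::int. real_of_int q = (real g + 1) / 2 \<and> g mod 2 = 1 \<and> g \<ge> 5
        \<longrightarrow> int (card (gapsets g q)) = \<lfloor>real g / 3\<rfloor> + 2) \<and>
     (\<forall>q::int. (real g + 2) / 2 \<le> real_of_int q \<and> real_of_int q \<le> 2 * real g / 3
        \<longrightarrow> card (gapsets g q) = 2) \<and>
     (\<forall>q::int. real_of_int q = (2 * real g + 1) / 3 \<and> g mod 3 = 1 \<and> g \<ge> 4
        \<longrightarrow> card (gapsets g q) = 1) \<and>
     (\<forall>q::int. real_of_int q = (2 * real g + 2) / 3 \<and> g mod 3 = 2 \<and> g \<ge> 5
        \<longrightarrow> card (gapsets g q) = 0) \<and>
     (\<forall>q::int. \<lceil>2 * real g / 3\<rceil> + 1 \<le> q \<and> q \<le> int g - 1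
        \<longrightarrow> card (gapsets g q) = 0) \<and>
     card (gapsets g (int g)) = 1 \<and>
     (\<forall>q::int. q > int g \<longrightarrow> card (gapsets g q) = 0)"
proof (intro conjI allI impI)
  show "card (gapsets g 1) = 1"
    using card_gapsets [of 1 g] kunz_lists_1 [OF assms] by simp
  \<comment> \<open>Makes the truncated subtraction in \<open>card_kunz_lists_2\<close> agree with
    the integer one.\<close>
  have "fib (Suc g) > 0" by (simp add: fib_neq_0_nat)
  then show "int (card (gapsets g 2)) = int (fib (g + 1)) - 1"
    using card_gapsets [of 2 g] card_kunz_lists_2 [of g] by simp
  show "card (gapsets g (int g)) = 1"
    using card_gapsets [OF assms] kunz_lists_self [OF assms] by simp
next
  fix q :: int
  assume "(2 * real g + 4) / 5 < real_of_int q \<and> real_of_int q \<le> (real g - 1) / 2 \<and> g \<ge> 23"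
  then have q: "2 * int g + 4 < 5 * q" "2 * q + 1 \<le> int g" "g \<ge> 23"
    by (simp add: field_simps; linarith)+
  then have "q > 0" using assms by linarith
  then obtain n where n: "q = int n" "n > 0" using zero_less_imp_eq_int by blast
  have "2 * g + 4 < 5 * n" "2 * n \<le> g" using q unfolding n by linarith+
  then have "card (gapsets g q) = (g + 2 * n) div 3 + 2"
    using q n by (simp add: card_gapsets card_kunz_lists_le_half)
  moreover have "\<lfloor>(real g + 2 * real_of_int q) / 3\<rfloor> = int ((g + 2 * n) div 3)"
    using floor_divide_of_nat_eq [where 'a = real, of "g + 2 * n" 3] n by simp
  ultimately show "int (card (gapsets g q)) = \<lfloor>(real g + 2 * real_of_int q) / 3\<rfloor> + 2" by simp
next
  fix q :: int
  assume "real_of_int q = real g / 2 \<and> g mod 2 = 0 \<and> g \<ge> 8"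
  then have q: "2 * q = int g" "g \<ge> 8"
    by (simp add: field_simps; linarith)+
  then have "q > 0" using assms by linarith
  then obtain n where n: "q = int n" "n > 0" using zero_less_imp_eq_int by blast
  have g: "g = 2 * n" using q unfolding n by linarith+
  then have "card (gapsets g q) = (g + 2 * n) div 3 + 2"
    using q n by (simp add: card_gapsets card_kunz_lists_le_half)
  moreover have "\<lfloor>2 * real g / 3\<rfloor> = int ((g + 2 * n) div 3)"
    using floor_divide_of_nat_eq [where 'a = real, of "g + 2 * n" 3] g by simp
  ultimately show "int (card (gapsets g q)) = \<lfloor>2 * real g / 3\<rfloor> + 2" by simp
next
  fix q :: int
  assume "real_of_int q = (real g + 1) / 2 \<and> g mod 2 = 1 \<and> g \<ge> 5"
  then have q: "2 * q = int g + 1" "g \<ge> 5"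
    by (simp add: field_simps; linarith)+
  then have "q > 0" using assms by linarith
  then obtain n where n: "q = int n" "n > 0" using zero_less_imp_eq_int by blast
  have "g + 1 = 2 * n" using q unfolding n by linarith+
  then have "card (gapsets g q) = g div 3 + 2"
    using q n by (simp add: card_gapsets card_kunz_lists_half)
  then show "int (card (gapsets g q)) = \<lfloor>real g / 3\<rfloor> + 2"
    using floor_divide_of_nat_eq [where 'a = real, of g 3] by simp
next
  fix q :: int
  assume "(real g + 2) / 2 \<le> real_of_int q \<and> real_of_int q \<le> 2 * real g / 3"
  then have q: "int g + 2 \<le> 2 * q" "3 * q \<le> 2 * int g"
    by (simp add: field_simps; linarith)+
  then have "q > 0" using assms by linarith
  then obtain n where n: "q = int n" "n > 0" using zero_less_imp_eq_int by blast
  have "g + 2 \<le> 2 * n" "3 * n \<le> 2 * g" using q unfolding n by linarith+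
  then show "card (gapsets g q) = 2"
    using n by (simp add: card_gapsets card_kunz_lists_ge_half)
next
  fix q :: int
  assume "real_of_int q = (2 * real g + 1) / 3 \<and> g mod 3 = 1 \<and> g \<ge> 4"
  then have q: "3 * q = 2 * int g + 1" "g \<ge> 4"
    by (simp add: field_simps; linarith)+
  then have "q > 0" using assms by linarith
  then obtain n where n: "q = int n" "n > 0" using zero_less_imp_eq_int by blast
  \<comment> \<open>Together with this equation, \<open>g \<ge> 4\<close> yields
    \<open>g + 2 \<le> 2 * n\<close>.\<close>
  have "3 * n = 2 * g + 1" using q unfolding n by linarith+
  then show "card (gapsets g q) = 1"
    using q n by (simp add: card_gapsets card_kunz_lists_ge_half)
next
  fix q :: int
  assume "real_of_int q = (2 * real g + 2) / 3 \<and> g mod 3 = 2 \<and> g \<ge> 5"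
  then have q: "3 * q = 2 * int g + 2" "g \<ge> 5"
    by (simp add: field_simps; linarith)+
  then have "q > 0" using assms by linarith
  then obtain n where n: "q = int n" "n > 0" using zero_less_imp_eq_int by blast
  have "3 * n = 2 * g + 2" using q unfolding n by linarith+
  then show "card (gapsets g q) = 0"
    using q n by (simp add: card_gapsets card_kunz_lists_ge_half)
next
  fix q :: int
  assume "\<lceil>2 * real g / 3\<rceil> + 1 \<le> q \<and> q \<le> int g - 1"
  \<comment> \<open>Dropping the ceiling still leaves \<open>2 * g + 3 \<le> 3 * q\<close>, which is
    past both nonzero cases of \<open>card_kunz_lists_ge_half\<close>.\<close>
  then have "2 * real g / 3 + 1 \<le> real_of_int q" "q \<le> int g - 1" by linarith+
  then have q: "2 * int g + 3 \<le> 3 * q" "q < int g"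
    by (simp add: field_simps; linarith)+
  then have "q > 0" using assms by linarith
  then obtain n where n: "q = int n" "n > 0" using zero_less_imp_eq_int by blast
  have "2 * g + 3 \<le> 3 * n" "n < g" using q unfolding n by linarith+
  then show "card (gapsets g q) = 0"
    using n by (simp add: card_gapsets card_kunz_lists_ge_half)
next
  fix q :: int
  assume q: "q > int g"
  then have "q > 0" by simp
  then obtain n where n: "q = int n" "n > 0" using zero_less_imp_eq_int by blast
  then show "card (gapsets g q) = 0"
    using q by (simp add: card_gapsets kunz_lists_greater)
qed

end
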